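(* For each integer $n\ge 0$, let $d_n$ be the smallest positive integer such that $d_n \cdot (1^n + 2^n + \cdots + x^n)$ is a polynomial in $x$ with integer coefficients, let $q_n := d_n/(n+1)$ (an integer), and let $M_n := \frac{n+2}{2}$ if $n$ is even and $M_n := \frac{n+2}{3}$ if $n$ is odd. Then for all $n \ge 0$, $$q_n = \prod_{\substack{p \le M_n \\ s_p(n+1) \ge p}} p,$$ the product running over primes $p$ (an empty product equals $1$). Moreover, the bound $M_n$ is sharp for infinitely many even values of $n$ and for infinitely many odd values of $n$, i.e., there are infinitely many even $n$ and infinitely many odd $n$ such that $M_n$ is a prime dividing $q_n$. In particular, the sequence $(q_n)_{n \ge 0}$ is unbounded.
   Context: Here $1^n+2^n+\cdots+x^n$ denotes the unique polynomial in $\mathbb{Q}[x]$ agreeing with this sum for all positive integers $x$. For a prime $p$ and an integer $x \ge 0$ with base-$p$ expansion $x = \alpha_0 + \alpha_1 p + \cdots + \alpha_r p^r$, $0 \le \alpha_j \le p-1$, the digit sum is $s_p(x) := \alpha_0 + \alpha_1 + \cdots + \alpha_r$. *)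

theory Defs
  imports "HOL-Computational_Algebra.Computational_Algebra"
begin

definition power_sum_poly :: "nat \<Rightarrow> rat poly" where
  "power_sum_poly n =
     (THE P. \<forall>x::nat. x > 0 \<longrightarrow> poly P (of_nat x) = (\<Sum>k=1..x. of_nat k ^ n))"

definition power_sum_denom :: "nat \<Rightarrow> nat" where
  "power_sum_denom n =
     (LEAST d. d > 0 \<and> (\<forall>i. coeff (smult (of_nat d) (power_sum_poly n)) i \<in> \<int>))"

text \<open>This is natural-number division; by itself it is the true quotient only
  when \<open>n + 1\<close> divides \<open>power_sum_denom n\<close>.\<close>

definition q_seq :: "nat \<Rightarrow> nat" where
  "q_seq n = power_sum_denom n div (n + 1)"

definition M_bound :: "nat \<Rightarrow> rat" where
  "M_bound n = (if even n then (of_nat n + 2) / 2 else (of_nat n + 2) / 3)"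

text \<open>For \<open>p \<ge> 2\<close>, the \<open>j\<close>-th base-\<open>p\<close> digit of \<open>x\<close> is \<open>(x div p ^ j) mod p\<close>, and it vanishes
  for \<open>j > x\<close> because \<open>x < p ^ x\<close>.\<close>

definition digit_sum :: "nat \<Rightarrow> nat \<Rightarrow> nat" where
  "digit_sum p x = (\<Sum>j\<le>x. (x div p ^ j) mod p)"


text \<open>The objects described by \<open>THE\<close> and \<open>LEAST\<close> above exist, and \<open>digit_sum\<close> agrees with the
  sum of the digits of any base-\<open>p\<close> expansion.\<close>

lemma power_sum_poly_exists:
  "\<exists>P::rat poly. \<forall>x::nat. poly P (of_nat x) = (\<Sum>k=1..x. of_nat k ^ n)"
proof (induction n rule: less_induct)
  case (less n)
  then have "\<forall>m\<in>{..<n}. \<exists>P::rat poly. \<forall>x::nat. poly P (of_nat x) = (\<Sum>k=1..x. of_nat k ^ m)"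
    by blast
  then obtain S :: "nat \<Rightarrow> rat poly"
    where S: "\<And>m x. m < n \<Longrightarrow> poly (S m) (of_nat x) = (\<Sum>k=1..x. of_nat k ^ m)"
    by (metis lessThan_iff bchoice)
  define T :: "rat poly" where
    "T = [:1, 1:] ^ (n + 1) - 1 - (\<Sum>j<n. smult (of_nat ((n + 1) choose j)) (S j))"
  have "poly T (of_nat x) = of_nat (n + 1) * (\<Sum>k=1..x. of_nat k ^ n)" for x
  proof (induction x)
    case 0
    have "poly (S j) 0 = 0" if "j < n" for j
      using S[OF that, of 0] by simp
    then show ?case
      by (simp add: T_def poly_sum poly_power)
  next
    case (Suc x)
    have step: "poly (S j) (of_nat (Suc x)) = poly (S j) (of_nat x) + of_nat (Suc x) ^ j"
      if "j < n" for j
      unfolding S[OF that] by simp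
    have binom: "(1 + of_nat (Suc x) :: rat) ^ (n + 1) =
        (\<Sum>j<n. of_nat ((n + 1) choose j) * of_nat (Suc x) ^ j)
        + of_nat (n + 1) * of_nat (Suc x) ^ n + of_nat (Suc x) ^ (n + 1)"
      using binomial_ring[of "of_nat (Suc x) :: rat" 1 "n + 1"]
      by (simp add: lessThan_Suc_atMost[symmetric] add.commute del: power_Suc of_nat_Suc)
    have "poly T (of_nat (Suc x)) =
        (1 + of_nat (Suc x)) ^ (n + 1) - 1
        - (\<Sum>j<n. of_nat ((n + 1) choose j) * (poly (S j) (of_nat x) + of_nat (Suc x) ^ j))"
      unfolding T_def
      by (simp add: poly_sum poly_power step del: of_nat_Suc power_Suc)
    also have "\<dots> = poly T (of_nat x) + of_nat (n + 1) * of_nat (Suc x) ^ n"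
      unfolding binom T_def
      by (simp add: poly_sum poly_power sum.distrib distrib_left del: power_Suc)
    finally show ?case
      using Suc.IH by (simp add: distrib_left del: of_nat_Suc)
  qed
  then have "poly (smult (inverse (of_nat (n + 1))) T) (of_nat x) = (\<Sum>k=1..x. of_nat k ^ n)" for x
    by (simp add: field_simps del: of_nat_Suc)
  then show ?case by blast
qed

lemma power_sum_poly_unique:
  fixes P Q :: "rat poly"
  assumes "\<And>x::nat. x > 0 \<Longrightarrow> poly P (of_nat x) = poly Q (of_nat x)"
  shows "P = Q"
proof (rule ccontr)
  assume "P \<noteq> Q"
  then have "finite {x. poly (P - Q) x = 0}"
    by (intro poly_roots_finite) simp
  moreover have "of_nat ` {0<..} \<subseteq> {x. poly (P - Q) x = 0}"
    using assms by auto
  ultimately have "finite ((of_nat :: nat \<Rightarrow> rat) ` {0<..})"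
    by (rule finite_subset[rotated])
  then show False
    by (simp add: finite_image_iff inj_on_def infinite_Ioi)
qed

lemma poly_power_sum_poly:
  assumes "x > 0"
  shows "poly (power_sum_poly n) (of_nat x) = (\<Sum>k=1..x. of_nat k ^ n)"
proof -
  obtain P :: "rat poly" where P: "\<And>x. poly P (of_nat x) = (\<Sum>k=1..x. of_nat k ^ n)"
    using power_sum_poly_exists by blast
  then have "power_sum_poly n = P"
    unfolding power_sum_poly_def
    by (intro the_equality power_sum_poly_unique) auto
  then show ?thesis using P by simp
qed

lemma integral_multiple_exists:
  fixes P :: "rat poly"
  shows "\<exists>d::nat. d > 0 \<and> (\<forall>i. coeff (smult (of_nat d) P) i \<in> \<int>)"
proof (induction P)
  case 0
  then show ?case by auto
next
  case (pCons a P)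
  then obtain d where d: "d > 0" "\<And>i. of_nat d * coeff P i \<in> \<int>" by auto
  obtain u v where uv: "quotient_of a = (u, v)" by force
  then have v: "v > 0" "a = of_int u / of_int v"
    using quotient_of_denom_pos quotient_of_div by auto
  have "of_nat (d * nat v) * coeff (pCons a P) i \<in> \<int>" for i
  proof (cases i)
    case 0
    then have "of_nat (d * nat v) * coeff (pCons a P) i = (of_int (int d * u) :: rat)"
      using v by simp
    then show ?thesis by (metis Ints_of_int)
  next
    case (Suc j)
    then have "of_nat (d * nat v) * coeff (pCons a P) i = of_int v * (of_nat d * coeff P j)"
      using v by simp
    then show ?thesis using d(2)[of j] by (metis Ints_mult Ints_of_int)
  qed
  then show ?case using d(1) v(1)
    by (intro exI[of _ "d * nat v"]) (simp del: coeff_pCons of_nat_mult smult_pCons)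
qed

lemma digit_sum_expansion:
  assumes "p \<ge> 2" and "\<And>j. j \<le> r \<Longrightarrow> \<alpha> j < p"
  shows "digit_sum p (\<Sum>j\<le>r. \<alpha> j * p ^ j) = (\<Sum>j\<le>r. \<alpha> j)"
proof -
  define \<beta> where "\<beta> j = (if j \<le> r then \<alpha> j else 0)" for j
  have \<beta>: "\<beta> j < p" for j using assms by (auto simp: \<beta>_def)
  have digit: "((\<Sum>j\<le>m. \<beta> j * p ^ j) div p ^ i) mod p = (if i \<le> m then \<beta> i else 0)" for m i
    using \<beta>
  proof (induction m arbitrary: \<beta> i)
    case 0
    show ?case
    proof (cases i)
      case 0
      then show ?thesis using "0.prems" by simp
    next
      case (Suc k)
      have "\<beta> 0 < p ^ i"
        using "0.prems"[of 0] assms(1) Suc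
        by (metis less_le_trans self_le_power zero_less_Suc One_nat_def Suc_1 Suc_leD)
      then show ?thesis using Suc by simp
    qed
  next
    case (Suc m)
    have split: "(\<Sum>j\<le>Suc m. \<beta> j * p ^ j) = \<beta> 0 + p * (\<Sum>j\<le>m. \<beta> (Suc j) * p ^ j)"
      by (subst sum.atMost_Suc_shift) (simp add: sum_distrib_left mult_ac)
    show ?case
    proof (cases i)
      case 0
      then show ?thesis unfolding split using Suc.prems[of 0] by simp
    next
      case (Suc k)
      have "(\<beta> 0 + p * (\<Sum>j\<le>m. \<beta> (Suc j) * p ^ j)) div p ^ i
          = (\<Sum>j\<le>m. \<beta> (Suc j) * p ^ j) div p ^ k"
        using Suc.prems[of 0] assms(1) by (simp add: Suc div_mult2_eq)
      then show ?thesis unfolding split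
        using Suc.IH[of "\<lambda>j. \<beta> (Suc j)" k] Suc.prems Suc by simp
    qed
  qed
  define x where "x = (\<Sum>j\<le>r. \<beta> j * p ^ j)"
  have x: "(\<Sum>j\<le>r. \<alpha> j * p ^ j) = x"
    unfolding x_def by (intro sum.cong) (auto simp: \<beta>_def)
  have d: "(x div p ^ i) mod p = \<beta> i" for i
    unfolding x_def digit by (simp add: \<beta>_def)
  have zero: "\<beta> i = 0" if "i > x" for i
  proof -
    have "x < p ^ i"
      using that assms(1) by (meson less_exp less_trans order_less_le_trans power_mono zero_le)
    then show ?thesis using d[of i] by simp
  qed
  have "digit_sum p x = (\<Sum>i\<le>x. \<beta> i)"
    unfolding digit_sum_def d ..
  also have "\<dots> = (\<Sum>i\<le>max x r. \<beta> i)"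
    by (intro sum.mono_neutral_left ballI zero) auto
  also have "\<dots> = (\<Sum>i\<le>r. \<beta> i)"
    by (intro sum.mono_neutral_right) (auto simp: \<beta>_def)
  also have "\<dots> = (\<Sum>i\<le>r. \<alpha> i)"
    by (intro sum.cong) (auto simp: \<beta>_def)
  finally show ?thesis unfolding x .
qed

end

theory Submission
  imports Defs "HOL-Number_Theory.Residue_Primitive_Roots" "HOL-Number_Theory.Modular_Inverse"
begin

text \<open>By Faulhaber's formula, \<open>m (1\<^sup>m\<^sup>-\<^sup>1 + \<dots> + x\<^sup>m\<^sup>-\<^sup>1) = \<Sum>k<m. (m choose k) B\<^sub>k x\<^bsup>m-k\<^esup>\<close>, so with
  \<open>m = n + 1\<close> the number \<open>q\<^sub>n\<close> is the denominator of the right-hand side. By von Staudt's theorem a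
  prime \<open>p\<close> divides it at most once, and it does so iff \<open>p\<close> does not divide \<open>m choose k\<close> for some
  \<open>0 < k < m\<close> with \<open>p - 1\<close> dividing \<open>k\<close>. By Lucas's theorem such a \<open>k\<close> has base-\<open>p\<close> digits bounded by those
  of \<open>m\<close>; since \<open>k\<close> is congruent to its digit sum modulo \<open>p - 1\<close>, it exists iff \<open>s\<^sub>p(m) \<ge> p\<close>.
  The bound is attained for \<open>m = 2 p - 1\<close> and, for odd \<open>p\<close>, for \<open>m = 3 p - 1\<close>.\<close>

hide_const (open) up_ring.monom up_ring.coeff Module.module.smult

section \<open>Rationals integral at a prime\<close>

text \<open>For prime \<open>p\<close> this is membership in the localization of the integers at
  \<open>p\<close>. Asking for some multiplier prime to \<open>p\<close>, not a reduced denominator,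
  reduces closure under sums and products to multiplying multipliers.\<close>

definition p_integral :: "nat \<Rightarrow> rat \<Rightarrow> bool" where
  "p_integral p r \<longleftrightarrow> (\<exists>b::nat. \<not> p dvd b \<and> of_nat b * r \<in> \<int>)"

lemma p_integral_Ints: "prime p \<Longrightarrow> r \<in> \<int> \<Longrightarrow> p_integral p r"
  unfolding p_integral_def by (intro exI[of _ 1]) (auto simp: prime_nat_iff)

lemma p_integral_of_nat [simp]: "prime p \<Longrightarrow> p_integral p (of_nat n)"
  by (simp add: p_integral_Ints)

lemma p_integral_mult:
  assumes "prime p" "p_integral p r" "p_integral p s"
  shows "p_integral p (r * s)"
proof -
  obtain a b where ab: "\<not> p dvd a" "of_nat a * r \<in> \<int>" "\<not> p dvd b" "of_nat b * s \<in> \<int>"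
    using assms unfolding p_integral_def by auto
  have "(of_nat a * r) * (of_nat b * s) \<in> \<int>" using ab(2,4) by (rule Ints_mult)
  then show ?thesis
    unfolding p_integral_def using ab assms(1)
    by (intro exI[of _ "a * b"]) (auto simp: prime_dvd_mult_iff mult_ac)
qed

lemma p_integral_add:
  assumes "prime p" "p_integral p r" "p_integral p s"
  shows "p_integral p (r + s)"
proof -
  obtain a b where ab: "\<not> p dvd a" "of_nat a * r \<in> \<int>" "\<not> p dvd b" "of_nat b * s \<in> \<int>"
    using assms unfolding p_integral_def by auto
  have "of_nat b * (of_nat a * r) + of_nat a * (of_nat b * s) \<in> \<int>"
    using Ints_mult[OF Ints_of_nat ab(2)] Ints_mult[OF Ints_of_nat ab(4)] by (rule Ints_add)
  then show ?thesis
    unfolding p_integral_def using ab assms(1)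
    by (intro exI[of _ "a * b"]) (auto simp: prime_dvd_mult_iff algebra_simps)
qed

lemma p_integral_minus: "p_integral p r \<Longrightarrow> p_integral p (- r)"
  unfolding p_integral_def by auto

lemma p_integral_diff:
  "prime p \<Longrightarrow> p_integral p r \<Longrightarrow> p_integral p s \<Longrightarrow> p_integral p (r - s)"
  using p_integral_add[of p r "- s"] p_integral_minus[of p s] by simp

lemma p_integral_sum:
  "prime p \<Longrightarrow> (\<And>i. i \<in> A \<Longrightarrow> p_integral p (f i)) \<Longrightarrow> p_integral p (sum f A)"
  by (induction A rule: infinite_finite_induct) (auto intro: p_integral_add p_integral_Ints)

lemma p_integral_cancel:
  assumes "prime p" "\<not> p dvd c" "p_integral p (of_nat c * r)"
  shows "p_integral p r"
proof -
  obtain b where "\<not> p dvd b" "of_nat b * (of_nat c * r) \<in> \<int>"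
    using assms unfolding p_integral_def by auto
  then show ?thesis
    unfolding p_integral_def using assms
    by (intro exI[of _ "b * c"]) (auto simp: prime_dvd_mult_iff mult_ac)
qed

lemma p_integral_inverse_iff:
  assumes "prime p" "n > 0"
  shows "p_integral p (1 / of_nat n) \<longleftrightarrow> \<not> p dvd n"
proof
  assume "p_integral p (1 / of_nat n)"
  then obtain b where b: "\<not> p dvd b" "of_nat b * (1 / of_nat n) \<in> (\<int> :: rat set)"
    unfolding p_integral_def by auto
  then obtain c where "of_nat b * (1 / of_nat n) = (of_int c :: rat)" by (auto elim: Ints_cases)
  then have "(of_int (int b) :: rat) = of_int (c * int n)" using assms by (simp add: field_simps)
  then have "int b = c * int n" by (simp only: of_int_eq_iff)
  then have "int n dvd int b" by simp
  then have "n dvd b" by (simp only: of_nat_dvd_iff)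
  then show "\<not> p dvd n" using b dvd_trans by blast
next
  assume "\<not> p dvd n"
  then show "p_integral p (1 / of_nat n)" unfolding p_integral_def using assms
    by (intro exI[of _ n]) auto
qed

text \<open>The size bound keeps the multiplicity of \<open>p\<close> in \<open>b\<close> at most
  \<open>a\<close>, so \<open>p ^ a\<close> absorbs the \<open>p\<close>-part of \<open>b\<close>
  and leaves a denominator prime to \<open>p\<close>.\<close>

lemma p_integral_power_divide:
  assumes "prime p" "b > 0" "b < p ^ (a + 1)"
  shows "p_integral p (of_nat p ^ a / of_nat b)"
proof -
  obtain u where u: "b = p ^ multiplicity p b * u" "\<not> p dvd u"
    using multiplicity_decompose'[of b p] assms by (metis not_prime_unit gr_implies_not0)
  have "p ^ multiplicity p b \<le> b" using assms(2) by (simp add: dvd_imp_le multiplicity_dvd)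
  then have "p ^ multiplicity p b < p ^ (a + 1)" using assms by linarith
  then have le: "multiplicity p b \<le> a"
    using assms(1) prime_gt_1_nat by (metis less_Suc_eq_le Suc_eq_plus1 power_less_imp_less_exp)
  have "u > 0" using u assms(2) by (cases u) auto
  have "p > 0" using assms(1) prime_gt_0_nat by blast
  have "of_nat p ^ a = (of_nat p ^ multiplicity p b * of_nat p ^ (a - multiplicity p b) :: rat)"
    using le by (simp flip: power_add)
  moreover have "(of_nat b :: rat) = of_nat p ^ multiplicity p b * of_nat u"
    by (subst u(1)) simp
  ultimately have "of_nat p ^ a / of_nat b
      = of_nat (p ^ (a - multiplicity p b)) * (1 / of_nat u :: rat)"
    using \<open>p > 0\<close> \<open>u > 0\<close> by (simp add: field_simps)
  then show ?thesis
    using p_integral_mult[OF assms(1)] p_integral_inverse_iff[OF assms(1)] u(2) \<open>u > 0\<close> assms(1)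
      p_integral_of_nat by metis
qed

text \<open>A prime dividing the reduced denominator would also have to divide the
  numerator.\<close>

lemma Ints_if_p_integral:
  assumes "\<And>p. prime p \<Longrightarrow> p_integral p r"
  shows "r \<in> \<int>"
proof -
  obtain u v where uv: "quotient_of r = (u, v)" by force
  then have v: "v > 0" "coprime u v" "r = of_int u / of_int v"
    using quotient_of_denom_pos quotient_of_div quotient_of_coprime by auto
  have "nat v = 1"
  proof (rule ccontr)
    assume "nat v \<noteq> 1"
    then obtain p where p: "prime p" "p dvd nat v" using prime_factor_nat by blast
    then have "int p dvd int (nat v)" by (simp only: of_nat_dvd_iff)
    then have pv: "int p dvd v" using v(1) by simp
    obtain b where b: "\<not> p dvd b" "of_nat b * r \<in> \<int>"
      using assms[OF p(1)] unfolding p_integral_def by auto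
    then obtain c where "of_nat b * r = of_int c" by (auto elim: Ints_cases)
    then have "(of_int (int b * u) :: rat) = of_int (c * v)" using v by (simp add: field_simps)
    then have "int b * u = c * v" by (simp only: of_int_eq_iff)
    then have "int p dvd int b * u" using pv by simp
    then have "int p dvd u" using p(1) b(1) by (auto simp: prime_dvd_mult_iff)
    then have "int p dvd 1" using pv v(2) coprime_common_divisor by blast
    then show False using p(1) by auto
  qed
  then have "v = 1" by simp
  then show ?thesis using v(3) by simp
qed

section \<open>Bernoulli numbers and the power sum polynomials\<close>

text \<open>The Bernoulli numbers with the convention \<open>B\<^sub>1 = 1/2\<close>.\<close>

fun bern :: "nat \<Rightarrow> rat" where
  "bern n = 1 - (\<Sum>k<n. of_nat (Suc n choose k) * bern k) / of_nat (Suc n)"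

declare bern.simps [simp del]

lemma bern_0: "bern 0 = 1"
  by (simp add: bern.simps[of 0])

lemma bern_Suc_0: "bern (Suc 0) = 1 / 2"
  by (simp add: bern.simps[of "Suc 0"] bern_0)

text \<open>For \<open>m = Suc n\<close> this is the recursion of \<open>bern\<close> with its last
  term \<open>Suc n * bern n\<close> moved back into the sum.\<close>

lemma sum_binomial_bern: "(\<Sum>k<m. of_nat (m choose k) * bern k) = of_nat m"
proof (cases m)
  case (Suc n)
  then show ?thesis
    by (simp add: bern.simps[of n] algebra_simps del: of_nat_Suc binomial_Suc_Suc)
qed simp

text \<open>In terms of the Bernoulli polynomial B_m this is B_m(x + 1) - B_m(1); leaving out the
  constant term \<open>k = m\<close> makes it vanish at 0, like the empty power sum.\<close>

definition bern_poly :: "nat \<Rightarrow> rat poly" where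
  "bern_poly m = (\<Sum>k<m. monom (of_nat (m choose k) * bern k) (m - k))"

lemma coeff_bern_poly:
  "coeff (bern_poly m) i = (if 0 < i \<and> i \<le> m then of_nat (m choose (m - i)) * bern (m - i) else 0)"
proof -
  have "coeff (bern_poly m) i
      = (\<Sum>k<m. if k = m - i \<and> 0 < i \<and> i \<le> m then of_nat (m choose k) * bern k else 0)"
    unfolding bern_poly_def coeff_sum coeff_monom by (intro sum.cong) auto
  also have "\<dots> = (if 0 < i \<and> i \<le> m then of_nat (m choose (m - i)) * bern (m - i) else 0)"
    by (auto simp: sum.delta)
  finally show ?thesis .
qed

lemma poly_bern_poly: "poly (bern_poly m) x = (\<Sum>k<m. of_nat (m choose k) * bern k * x ^ (m - k))"
  by (simp add: bern_poly_def poly_sum poly_monom)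

text \<open>The difference equation of the Bernoulli polynomials. Expanding each
  \<open>(1 + x) ^ (m - k)\<close> and exchanging the sums leaves inner sums that the recursion of
  \<open>bern\<close> evaluates.\<close>

lemma binomial_bern_convolution:
  "(\<Sum>k\<le>m. of_nat (m choose k) * bern k * (1 + x) ^ (m - k))
    = (\<Sum>k\<le>m. of_nat (m choose k) * bern k * x ^ (m - k)) + of_nat m * (1 + x) ^ (m - 1)"
proof -
  have "(\<Sum>k\<le>m. of_nat (m choose k) * bern k * (1 + x) ^ (m - k))
      = (\<Sum>k\<le>m. \<Sum>j\<le>m - k. of_nat ((m choose k) * ((m - k) choose j)) * bern k * x ^ j)"
    by (subst add.commute, subst binomial_ring) (simp add: sum_distrib_left mult_ac)
  also have "\<dots> = (\<Sum>(k, j)\<in>(SIGMA k:{..m}. {..m - k}).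
      of_nat ((m choose k) * ((m - k) choose j)) * bern k * x ^ j)"
    by (rule sum.Sigma) auto
  also have "\<dots> = (\<Sum>(j, k)\<in>(SIGMA j:{..m}. {..m - j}).
      of_nat ((m choose j) * ((m - j) choose k)) * bern k * x ^ j)"
  proof (rule sum.reindex_bij_witness[of _ "\<lambda>(j, k). (k, j)" "\<lambda>(j, k). (k, j)"], goal_cases)
    case (5 a)
    obtain k j where a: "a = (k, j)" by force
    then have "k + j \<le> m" using 5 by auto
    \<comment> \<open>Both sides equal
      \<open>(m choose (k + j)) * ((k + j) choose k)\<close>.\<close>
    then have "(m choose k) * ((m - k) choose j) = (m choose j) * ((m - j) choose k)"
      using choose_mult[of k "k + j" m] choose_mult[of j "k + j" m] binomial_symmetric[of k "k + j"]
      by simp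
    then show ?case by (simp only: a case_prod_conv)
  qed auto
  also have "\<dots> = (\<Sum>j\<le>m. of_nat (m choose j) * x ^ j * (\<Sum>k\<le>m - j. of_nat ((m - j) choose k) * bern k))"
    by (subst sum.Sigma[symmetric]) (auto simp: sum_distrib_left mult_ac)
  \<comment> \<open>The top term of the inner sum is \<open>bern (m - j)\<close>;
    \<open>sum_binomial_bern\<close> gives the rest.\<close>
  also have "\<dots> = (\<Sum>j\<le>m. of_nat (m choose j) * x ^ j * (bern (m - j) + of_nat (m - j)))"
    using sum_binomial_bern by (simp add: lessThan_Suc_atMost[symmetric] add.commute)
  also have "\<dots> = (\<Sum>j\<le>m. of_nat (m choose j) * bern (m - j) * x ^ j)
      + (\<Sum>j\<le>m. of_nat ((m choose j) * (m - j)) * x ^ j)"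
    unfolding sum.distrib[symmetric] by (intro sum.cong) (simp_all add: ring_distribs mult_ac del: of_nat_diff)
  also have "(\<Sum>j\<le>m. of_nat (m choose j) * bern (m - j) * x ^ j)
      = (\<Sum>k\<le>m. of_nat (m choose k) * bern k * x ^ (m - k))"
    by (rule sum.reindex_bij_witness[of _ "\<lambda>k. m - k" "\<lambda>k. m - k"])
       (auto simp: binomial_symmetric[symmetric])
  also have "(\<Sum>j\<le>m. of_nat ((m choose j) * (m - j)) * x ^ j) = of_nat m * (1 + x) ^ (m - 1)"
  proof (cases m)
    case (Suc n)
    have *: "(m choose j) * (m - j) = m * (n choose j)" if "j \<le> n" for j
      using binomial_absorb_comp[of m j] Suc by (simp add: mult.commute)
    have "(\<Sum>j\<le>m. of_nat ((m choose j) * (m - j)) * x ^ j)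
        = (\<Sum>j\<le>n. of_nat ((m choose j) * (m - j)) * x ^ j)"
      using Suc by simp
    also have "\<dots> = (\<Sum>j\<le>n. of_nat (m * (n choose j)) * x ^ j)"
      by (intro sum.cong refl) (simp only: * atMost_iff)
    also have "\<dots> = of_nat m * (x + 1) ^ n"
      by (subst binomial_ring) (simp add: sum_distrib_left mult_ac)
    finally show ?thesis using Suc by (simp add: add.commute)
  qed simp
  finally show ?thesis .
qed

text \<open>The convolution identity supplies the increment from \<open>x\<close> to
  \<open>x + 1\<close>; the constant term missing from \<open>bern_poly\<close> cancels in
  it.\<close>

lemma poly_bern_poly_of_nat:
  "poly (bern_poly (Suc n)) (of_nat x) = of_nat (Suc n) * (\<Sum>j=1..x. of_nat j ^ n)"
proof (induction x)
  case 0
  show ?case by (simp add: poly_bern_poly del: binomial_Suc_Suc) (intro sum.neutral, auto)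
next
  case (Suc x)
  have "poly (bern_poly (Suc n)) (1 + of_nat x)
      = poly (bern_poly (Suc n)) (of_nat x) + of_nat (Suc n) * (1 + of_nat x) ^ n"
    using binomial_bern_convolution[of "Suc n" "of_nat x"]
    by (simp add: poly_bern_poly lessThan_Suc_atMost[symmetric] del: binomial_Suc_Suc of_nat_Suc)
  then show ?case using Suc.IH by (simp add: algebra_simps)
qed

lemma power_sum_poly_eq: "smult (of_nat (Suc n)) (power_sum_poly n) = bern_poly (Suc n)"
  by (rule power_sum_poly_unique) (simp only: poly_smult poly_power_sum_poly poly_bern_poly_of_nat)

section \<open>Von Staudt's congruence\<close>

text \<open>If \<open>p - 1\<close> divides \<open>k\<close>, Fermat makes each of the
  \<open>p - 1\<close> nonzero residues contribute 1. Otherwise multiplication by a primitive root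
  \<open>g\<close> permutes them, so \<open>g ^ k - 1\<close>, a unit modulo \<open>p\<close>,
  annihilates the sum.\<close>

lemma int_power_sum_cong_prime:
  fixes p k :: nat
  assumes p: "prime p" and k: "k > 0"
  shows "[(\<Sum>j=1..p. int j ^ k) = (if (p - 1) dvd k then -1 else 0)] (mod int p)"
proof -
  have p1: "p > 1" using p prime_gt_1_nat by blast
  have "(\<Sum>j=1..p. int j ^ k) = (\<Sum>j=1..<p. int j ^ k) + int p ^ k"
    using p1 by (simp add: sum.last_plus add.commute)
  also have "(\<Sum>j=1..<p. int j ^ k) = (\<Sum>j\<in>{1..<int p}. j ^ k)"
    by (rule sum.reindex_bij_witness[of _ nat int]) auto
  finally have eq: "(\<Sum>j=1..p. int j ^ k) = (\<Sum>j\<in>{1..<int p}. j ^ k) + int p ^ k" .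
  have pk: "[int p ^ k = 0] (mod int p)" using k by (simp add: cong_0_iff)
  show ?thesis
  proof (cases "(p - 1) dvd k")
    case True
    then obtain c where c: "k = (p - 1) * c" by auto
    have "[j ^ k = 1] (mod int p)" if "j \<in> {1..<int p}" for j
    proof -
      have "\<not> p dvd nat j" using that by (auto dest: dvd_imp_le)
      then have "[nat j ^ (p - 1) = 1] (mod p)" using p fermat_theorem by blast
      then have "[nat j ^ k = 1] (mod p)" unfolding c power_mult using cong_pow[of _ 1 p c] by fastforce
      then have "[int (nat j ^ k) = int 1] (mod int p)" by (simp only: cong_int_iff)
      then show ?thesis using that by simp
    qed
    then have "[(\<Sum>j\<in>{1..<int p}. j ^ k) = (\<Sum>j\<in>{1..<int p}. 1)] (mod int p)"
      by (rule cong_sum)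
    then have "[(\<Sum>j\<in>{1..<int p}. j ^ k) + int p ^ k = (int p - 1) + 0] (mod int p)"
      using p1 by (intro cong_add pk) simp
    also have "[int p - 1 + 0 = -1] (mod int p)" by (simp add: cong_iff_dvd_diff)
    finally show ?thesis using True eq by simp
  next
    case False
    obtain g where g: "residue_primroot p g" using prime_primitive_root_exists[OF prime_gt_1_nat[OF p] p] by blast
    then have gc: "coprime (int g) (int p)" and go: "ord p g = p - 1"
      using p by (auto simp: residue_primroot_def totient_prime coprime_commute)
    let ?S = "\<Sum>j\<in>{1..<int p}. j ^ k"
    have "?S = (\<Sum>j\<in>{1..<int p}. (int g * j mod int p) ^ k)"
      by (rule sum.reindex_bij_betw[OF bij_betw_int_remainders_mult[OF gc], symmetric])
    also have "[\<dots> = (\<Sum>j\<in>{1..<int p}. (int g * j) ^ k)] (mod int p)"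
      by (intro cong_sum cong_pow) (simp add: cong_def)
    also have "(\<Sum>j\<in>{1..<int p}. (int g * j) ^ k) = int g ^ k * ?S"
      by (simp add: power_mult_distrib sum_distrib_left)
    finally have "int p dvd (int g ^ k - 1) * ?S"
      by (simp add: cong_iff_dvd_diff algebra_simps dvd_diff_commute)
    moreover have "\<not> int p dvd int g ^ k - 1"
    proof
      assume "int p dvd int g ^ k - 1"
      then have "[int (g ^ k) = int 1] (mod int p)" by (simp add: cong_iff_dvd_diff)
      then have "[g ^ k = 1] (mod p)" by (simp only: cong_int_iff)
      then show False using False go ord_divides by metis
    qed
    ultimately have "[?S = 0] (mod int p)" using p by (simp add: prime_dvd_mult_iff cong_0_iff)
    then have "[?S + int p ^ k = 0 + 0] (mod int p)" by (intro cong_add pk)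
    then show ?thesis using False eq by simp
  qed
qed

text \<open>Faulhaber's formula at \<open>x = p\<close>, divided by \<open>k + 1\<close> and solved
  for the term \<open>j = k\<close>. One factor \<open>p\<close> stays with each Bernoulli number
  because that product is what is \<open>p\<close>-integral.\<close>

lemma bern_power_sum:
  "of_nat p * bern k = (\<Sum>j=1..p. of_nat j ^ k)
     - (\<Sum>j<k. of_nat (k choose j) * (of_nat p * bern j) * (of_nat p ^ (k - j) / of_nat (k - j + 1)))"
proof -
  have *: "(of_nat (Suc k choose j) :: rat) = of_nat (Suc k) * (of_nat (k choose j) / of_nat (k - j + 1))"
    if "j \<le> k" for j
  proof -
    have "(Suc k choose j) * (k - j + 1) = Suc k * (k choose j)"
      using binomial_absorb_comp[of "Suc k" j] that by (simp add: Suc_diff_le mult.commute)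
    then have "(of_nat (Suc k choose j) :: rat) * of_nat (k - j + 1) = of_nat (Suc k) * of_nat (k choose j)"
      by (metis of_nat_mult)
    then show ?thesis by (simp add: field_simps del: of_nat_Suc binomial_Suc_Suc)
  qed
  have "of_nat (Suc k) * (\<Sum>j=1..p. of_nat j ^ k)
      = (\<Sum>j\<le>k. of_nat (Suc k choose j) * bern j * of_nat p ^ (Suc k - j))"
    using poly_bern_poly_of_nat[of k p]
    by (simp add: poly_bern_poly lessThan_Suc_atMost del: binomial_Suc_Suc of_nat_Suc)
  also have "\<dots> = (\<Sum>j\<le>k. of_nat (Suc k) * (of_nat (k choose j) * (of_nat p * bern j)
      * (of_nat p ^ (k - j) / of_nat (k - j + 1))))"
    by (intro sum.cong refl) (simp add: * Suc_diff_le mult_ac del: of_nat_Suc binomial_Suc_Suc)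
  also have "\<dots> = of_nat (Suc k) * (\<Sum>j\<le>k. of_nat (k choose j) * (of_nat p * bern j)
      * (of_nat p ^ (k - j) / of_nat (k - j + 1)))"
    by (rule sum_distrib_left[symmetric])
  finally have "(\<Sum>j=1..p. of_nat j ^ k) = (\<Sum>j\<le>k. of_nat (k choose j) * (of_nat p * bern j)
      * (of_nat p ^ (k - j) / of_nat (k - j + 1)))"
    by (simp only: mult_cancel_left of_nat_eq_0_iff) auto
  then show ?thesis by (simp add: lessThan_Suc_atMost[symmetric])
qed

text \<open>By \<open>p_integral_power_divide\<close>, this makes
  \<open>p ^ (i - 1) / (i + 1)\<close> integral at \<open>p\<close>. The excluded case is the
  equality \<open>1 + 1 = 2 ^ 1\<close>.\<close>

lemma Suc_less_prime_power:
  assumes "prime p" "i \<ge> 1" "p = 2 \<Longrightarrow> i \<ge> 2"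
  shows "i + 1 < p ^ i"
proof (cases "p = 2")
  case True
  have "i + 1 < 2 ^ i" if "i \<ge> 2" for i :: nat
    using that by (induction i rule: dec_induct) auto
  then show ?thesis using True assms by auto
next
  case False
  then have "p \<ge> 3" using assms(1) prime_ge_2_nat[of p] by linarith
  have "i + 1 < 3 ^ i" using assms(2) by (induction i rule: dec_induct) auto
  also have "(3::nat) ^ i \<le> p ^ i" using \<open>p \<ge> 3\<close> by (simp add: power_mono)
  finally show ?thesis .
qed

text \<open>Strong induction along \<open>bern_power_sum\<close>: the power sum is an integer, and
  each weight is \<open>p\<close>-integral because \<open>k - j + 1\<close> is below
  \<open>p ^ (k - j + 1)\<close>.\<close>

lemma p_integral_times_bern:
  assumes p: "prime p"
  shows "p_integral p (of_nat p * bern k)"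
proof (induction k rule: less_induct)
  case (less k)
  have "p_integral p (of_nat p ^ (k - j) / of_nat (k - j + 1))" if "j < k" for j
  proof (rule p_integral_power_divide[OF p])
    have "k - j + 1 \<le> 2 ^ (k - j)" by (simp add: Suc_leI)
    also have "\<dots> \<le> p ^ (k - j)" using prime_ge_2_nat[OF p] by (simp add: power_mono)
    also have "\<dots> < p ^ (k - j + 1)" using prime_gt_1_nat[OF p] by simp
    finally show "k - j + 1 < p ^ (k - j + 1)" .
  qed simp
  then have "p_integral p (of_nat (k choose j) * (of_nat p * bern j)
      * (of_nat p ^ (k - j) / of_nat (k - j + 1)))" if "j < k" for j
    using p_integral_mult p_integral_of_nat less.IH p that by metis
  moreover have "(\<Sum>j=1..p. of_nat j ^ k) \<in> (\<int> :: rat set)" by (intro Ints_sum Ints_power) auto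
  ultimately show ?case
    unfolding bern_power_sum[of p k]
    by (intro p_integral_diff[OF p] p_integral_sum[OF p, of "{..<k}"]) (simp_all only: lessThan_iff p_integral_Ints[OF p])
qed

text \<open>The weights \<open>p ^ i / (i + 1)\<close> in \<open>bern_power_sum\<close> are divisible by \<open>p\<close> except for \<open>p = 2\<close>,
  \<open>i = 1\<close>; that term carries an extra factor \<open>k\<close>, which is harmless for even \<open>k\<close>.\<close>

lemma von_staudt:
  assumes p: "prime p" and k: "k > 0" and p2: "p = 2 \<Longrightarrow> k = 1 \<or> even k"
  shows "p_integral p (bern k + (if (p - 1) dvd k then 1 / of_nat p else 0))"
proof (cases "p = 2 \<and> k = 1")
  case True
  then show ?thesis using p_integral_Ints[OF p, of 1] by (simp add: bern_Suc_0)
next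
  case False
  have p0: "(of_nat p :: rat) \<noteq> 0" using p prime_gt_0_nat by fastforce
  let ?t = "\<lambda>j. of_nat (k choose j) * (of_nat p * bern j) * (of_nat p ^ (k - j) / of_nat (k - j + 1))"
  let ?e = "if (p - 1) dvd k then -1 else 0 :: int"
  have t: "p_integral p (?t j / of_nat p)" if j: "j < k" for j
  proof (cases "p = 2 \<and> j = k - 1")
    case True
    then obtain l where l: "k = 2 * l" using False p2 by auto
    have "k choose j = k" using True k by (cases k) auto
    then have "?t j / of_nat p = of_nat l * (of_nat p * bern j)"
      using True k j l by (simp add: field_simps)
    then show ?thesis using p_integral_mult p_integral_times_bern p by simp
  next
    case nf: False
    \<comment> \<open>Dividing by \<open>p\<close> lowers the exponent \<open>k - j\<close> to
      \<open>i\<close>, so integrality now needs the sharper bound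
      \<open>k - j + 1 < p ^ (k - j)\<close>.\<close>
    define i where "i = k - j - 1"
    then have ki: "k - j = i + 1" using j by simp
    have "p_integral p (of_nat p ^ i / of_nat (k - j + 1))"
    proof (rule p_integral_power_divide[OF p])
      show "k - j + 1 < p ^ (i + 1)"
        using Suc_less_prime_power[OF p, of "k - j"] nf j ki by force
    qed simp
    moreover have "?t j / of_nat p
        = of_nat (k choose j) * (of_nat p * bern j) * (of_nat p ^ i / of_nat (k - j + 1))"
      using p0 by (simp add: ki)
    ultimately show ?thesis
      using p_integral_mult p_integral_times_bern p p_integral_of_nat by metis
  qed
  obtain c where c: "(\<Sum>j=1..p. int j ^ k) - ?e = int p * c"
    using int_power_sum_cong_prime[OF p k] unfolding cong_iff_dvd_diff by blast
  have "(\<Sum>j=1..p. of_nat j ^ k) = (of_int (\<Sum>j=1..p. int j ^ k) :: rat)" by simp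
  also have "(\<Sum>j=1..p. int j ^ k) = ?e + int p * c" using c by linarith
  finally have "of_nat p * bern k = of_int ?e + of_nat p * of_int c - (\<Sum>j<k. ?t j)"
    using bern_power_sum[of p k] by simp
  \<comment> \<open>Division by \<open>p\<close> turns the residue -1 of the power sum into the
    summand \<open>1 / p\<close> on the left.\<close>
  then have "bern k + (if (p - 1) dvd k then 1 / of_nat p else 0)
      = of_int c - (\<Sum>j<k. ?t j) / of_nat p"
    using p0 by (auto simp: field_simps)
  also have "\<dots> = of_int c - (\<Sum>j<k. ?t j / of_nat p)" by (simp only: sum_divide_distrib)
  finally show ?thesis
    using p_integral_diff[OF p p_integral_Ints[OF p Ints_of_int] p_integral_sum[OF p t, of "{..<k}" "\<lambda>j. j"]]
    by (simp only: lessThan_iff)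
qed

section \<open>Binomial coefficients modulo a prime and digit sums\<close>

text \<open>In Vandermonde's sum, \<open>p choose i\<close> vanishes modulo \<open>p\<close> unless
  \<open>i\<close> is 0 or \<open>p\<close>.\<close>

lemma choose_add_prime_cong:
  assumes p: "prime p"
  shows "[(p + N) choose j = (N choose j) + (if p \<le> j then N choose (j - p) else 0)] (mod p)"
proof -
  have p0: "p > 0" using p prime_gt_0_nat by blast
  have "[\<Sum>i\<le>j. (p choose i) * (N choose (j - i))
      = \<Sum>i\<le>j. (if i = 0 then N choose j else 0) + (if i = p then N choose (j - p) else 0)] (mod p)"
  proof (rule cong_sum)
    fix i
    have "p dvd p choose i" if "i \<noteq> 0" "i < p" using dvd_choose_prime that p p0 by blast
    then show "[(p choose i) * (N choose (j - i))
        = (if i = 0 then N choose j else 0) + (if i = p then N choose (j - p) else 0)] (mod p)"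
      using p0 by (cases i p rule: linorder_cases) (auto simp: cong_0_iff binomial_eq_0)
  qed
  moreover have "(\<Sum>i\<le>j. (if i = 0 then N choose j else 0) + (if i = p then N choose (j - p) else 0))
      = (N choose j) + (if p \<le> j then N choose (j - p) else 0)"
    by (simp add: sum.distrib)
  ultimately show ?thesis by (simp add: vandermonde)
qed

text \<open>Lucas's theorem for the last digit. Raising \<open>a\<close> by one adds
  \<open>p\<close> to the upper argument, and the two surviving terms recombine by Pascal's
  rule.\<close>

lemma lucas_cong:
  assumes p: "prime p" and b: "b < p" and d: "d < p"
  shows "[(p * a + b) choose (p * c + d) = (a choose c) * (b choose d)] (mod p)"
proof (induction a arbitrary: c)
  case 0
  then show ?case using b by (cases c) (auto simp: binomial_eq_0)
next
  case (Suc a)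
  have "[(p + (p * a + b)) choose (p * c + d)
      = ((p * a + b) choose (p * c + d))
        + (if p \<le> p * c + d then (p * a + b) choose (p * c + d - p) else 0)] (mod p)"
    by (rule choose_add_prime_cong[OF p])
  also have "[((p * a + b) choose (p * c + d))
        + (if p \<le> p * c + d then (p * a + b) choose (p * c + d - p) else 0)
      = (a choose c) * (b choose d) + (if c > 0 then (a choose (c - 1)) * (b choose d) else 0)] (mod p)"
  proof (rule cong_add)
    show "[(if p \<le> p * c + d then (p * a + b) choose (p * c + d - p) else 0)
        = (if c > 0 then (a choose (c - 1)) * (b choose d) else 0)] (mod p)"
      using Suc.IH[of "c - 1"] d by (cases c) auto
  qed (rule Suc.IH)
  also have "(a choose c) * (b choose d) + (if c > 0 then (a choose (c - 1)) * (b choose d) else 0)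
      = (Suc a choose c) * (b choose d)"
    by (cases c) (auto simp: algebra_simps)
  finally show ?case by (simp add: algebra_simps)
qed

lemma prime_not_dvd_choose: "prime p \<Longrightarrow> d \<le> b \<Longrightarrow> b < p \<Longrightarrow> \<not> p dvd (b choose d)" for p :: nat
  using binomial_fact_lemma[of d b] prime_dvd_fact_iff[of p b]
  by (metis dvd_triv_right dvd_mult not_le)

lemma prime_dvd_choose_iff:
  assumes "prime p" "b < p" "d < p"
  shows "p dvd ((p * a + b) choose (p * c + d)) \<longleftrightarrow> p dvd (a choose c) \<or> b < d"
proof -
  have "p dvd ((p * a + b) choose (p * c + d)) \<longleftrightarrow> p dvd (a choose c) * (b choose d)"
    using lucas_cong[OF assms] cong_dvd_iff by blast
  also have "\<dots> \<longleftrightarrow> p dvd (a choose c) \<or> p dvd (b choose d)"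
    using assms(1) by (simp add: prime_dvd_mult_iff)
  also have "p dvd (b choose d) \<longleftrightarrow> b < d"
    using prime_not_dvd_choose[of p d b] assms by (cases "d \<le> b") (auto simp: binomial_eq_0)
  finally show ?thesis .
qed

section \<open>Digit sums in base \<open>p\<close>\<close>

lemma digit_sum_extend:
  assumes "p \<ge> 2" "x \<le> N"
  shows "digit_sum p x = (\<Sum>j\<le>N. (x div p ^ j) mod p)"
  unfolding digit_sum_def
proof (rule sum.mono_neutral_left)
  show "\<forall>j\<in>{..N} - {..x}. x div p ^ j mod p = 0"
  proof
    fix j assume "j \<in> {..N} - {..x}"
    then have "x < j" by simp
    also have "j < 2 ^ j" by simp
    also have "(2::nat) ^ j \<le> p ^ j" using assms by (simp add: power_mono)
    finally show "x div p ^ j mod p = 0" by simp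
  qed
qed (use assms in auto)

lemma digit_sum_rec:
  assumes "p \<ge> 2" "b < p"
  shows "digit_sum p (p * a + b) = digit_sum p a + b"
proof -
  have le: "a \<le> p * a + b" using assms by (simp add: trans_le_add1)
  \<comment> \<open>One extra zero digit is summed, so that splitting off \<open>j = 0\<close>
    leaves the range up to \<open>p * a + b\<close>, which still covers all digits of
    \<open>a\<close>.\<close>
  have "digit_sum p (p * a + b) = (\<Sum>j\<le>Suc (p * a + b). ((p * a + b) div p ^ j) mod p)"
    by (rule digit_sum_extend) (use assms in auto)
  also have "\<dots> = b + (\<Sum>j\<le>p * a + b. ((p * a + b) div p div p ^ j) mod p)"
    using assms by (subst sum.atMost_Suc_shift) (simp add: div_mult2_eq)
  also have "(p * a + b) div p = a" using assms by simp
  also have "(\<Sum>j\<le>p * a + b. (a div p ^ j) mod p) = digit_sum p a"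
    by (rule digit_sum_extend[OF assms(1) le, symmetric])
  finally show ?thesis by simp
qed

lemma digit_sum_less: "p \<ge> 2 \<Longrightarrow> b < p \<Longrightarrow> digit_sum p b = b"
  using digit_sum_rec[of p b 0] by (simp add: digit_sum_def)

text \<open>Induction on the base-\<open>p\<close> expansion, justified by
  \<open>x div p < x\<close> for positive \<open>x\<close>; the positivity premise of the step
  excludes appending the digit 0 to 0.\<close>

lemma base_induct [consumes 1, case_names zero step]:
  fixes p :: nat
  assumes "p \<ge> 2" "P 0" "\<And>a b. b < p \<Longrightarrow> p * a + b > 0 \<Longrightarrow> P a \<Longrightarrow> P (p * a + b)"
  shows "P x"
proof (induction x rule: less_induct)
  case (less x)
  show ?case
  proof (cases "x = 0")
    case False
    then have "P (p * (x div p) + x mod p)"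
      using assms(1) less[of "x div p"] by (intro assms(3)) auto
    then show ?thesis by simp
  qed (use assms in simp)
qed

lemma digit_sum_le:
  assumes "p \<ge> 2"
  shows "digit_sum p x \<le> x"
  using assms
proof (induction x rule: base_induct)
  case (step a b)
  have "1 * a \<le> p * a" using assms by (intro mult_le_mono1) simp
  then have "a \<le> p * a" by simp
  then show ?case using step le_trans by (fastforce simp: digit_sum_rec[OF assms])
qed (simp add: digit_sum_def)

lemma digit_sum_pos:
  assumes "p \<ge> 2"
  shows "x > 0 \<Longrightarrow> digit_sum p x > 0"
  using assms
proof (induction x rule: base_induct)
  case (step a b)
  then show ?case using digit_sum_rec[OF assms, of b a] by (cases "a > 0") auto
qed simp

text \<open>Since \<open>p\<close> is 1 modulo \<open>p - 1\<close>, every number is congruent to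
  its digit sum.\<close>

lemma dvd_digit_sum_iff:
  assumes "p \<ge> 2"
  shows "(p - 1) dvd digit_sum p x \<longleftrightarrow> (p - 1) dvd x"
proof -
  have "[digit_sum p x = x] (mod (p - 1))" using assms
  proof (induction x rule: base_induct)
    case (step a b)
    have "[digit_sum p a + b = a + b + (p - 1) * a] (mod (p - 1))"
      using cong_add[OF step(3) cong_refl[of b]] by (simp add: cong_def)
    also have "a + b + (p - 1) * a = p * a + b" using assms by (cases p) auto
    finally show ?case using assms step by (simp add: digit_sum_rec)
  qed (simp add: digit_sum_def)
  then show ?thesis by (rule cong_dvd_iff)
qed

text \<open>By Lucas no digit of \<open>k\<close> exceeds that of \<open>m\<close>, and
  \<open>k < m\<close> makes some digit strictly smaller.\<close>

lemma digit_sum_less_if_not_dvd_choose: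
  assumes p: "prime p"
  shows "k < m \<Longrightarrow> \<not> p dvd (m choose k) \<Longrightarrow> digit_sum p k < digit_sum p m"
  using prime_ge_2_nat[OF p]
proof (induction m arbitrary: k rule: base_induct)
  case (step a b)
  define c d where "c = k div p" and "d = k mod p"
  have k: "k = p * c + d" and d: "d < p" using step(1) by (auto simp: c_def d_def)
  have *: "\<not> p dvd (a choose c)" "d \<le> b"
    using step.prems prime_dvd_choose_iff[OF p step(1) d, of a c] by (auto simp: k)
  have "c \<le> a" using *(1) by (metis binomial_eq_0 dvd_0_right not_le)
  then consider "c < a" | "c = a" "d < b" using * step.prems k by force
  then show ?case
    using step * d prime_ge_2_nat[OF p] by cases (auto simp: digit_sum_rec k intro: add_less_le_mono)
qed simp

text \<open>The digits of \<open>k\<close> are taken greedily from those of \<open>m\<close>, lowest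
  first: \<open>t\<close> itself if it fits into the last digit \<open>b\<close>, otherwise all of
  \<open>b\<close> and the rest \<open>t - b\<close> from \<open>a\<close>.\<close>

lemma exists_not_dvd_choose_digit_sum:
  assumes p: "prime p"
  shows "t \<le> digit_sum p m \<Longrightarrow> \<exists>k\<le>m. digit_sum p k = t \<and> \<not> p dvd (m choose k)"
  using prime_ge_2_nat[OF p]
proof (induction m arbitrary: t rule: base_induct)
  case zero
  then show ?case using p by (auto simp: digit_sum_def)
next
  case (step a b)
  note p2 = prime_ge_2_nat[OF p]
  show ?case
  proof (cases "t \<le> b")
    case True
    then have "\<not> p dvd ((p * a + b) choose (p * 0 + t))"
      using step(1) p by (subst prime_dvd_choose_iff) auto
    then show ?thesis using True step(1) p2 by (intro exI[of _ t]) (auto simp: digit_sum_less)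
  next
    case False
    then have "t - b \<le> digit_sum p a" using step p2 by (simp add: digit_sum_rec)
    then obtain c where c: "c \<le> a" "digit_sum p c = t - b" "\<not> p dvd (a choose c)"
      using step.IH by blast
    then have "\<not> p dvd ((p * a + b) choose (p * c + b))"
      using step(1) p by (subst prime_dvd_choose_iff) auto
    then show ?thesis using False c step(1) p2
      by (intro exI[of _ "p * c + b"]) (auto simp: digit_sum_rec)
  qed
qed

section \<open>Denominators\<close>

text \<open>Only \<open>bern k\<close> with \<open>k > 0\<close> and \<open>p - 1\<close> dividing
  \<open>k\<close> can contain \<open>1 / p\<close>. Then the digit sum of \<open>k\<close> is a
  positive multiple of \<open>p - 1\<close>, hence not below that of \<open>m\<close>, so
  \<open>p\<close> divides \<open>m choose k\<close> and cancels the denominator.\<close>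

lemma p_integral_coeff_bern_poly:
  assumes p: "prime p" and s: "digit_sum p m < p"
  shows "p_integral p (coeff (bern_poly m) i)"
proof -
  have "p_integral p (of_nat (m choose k) * bern k)" if k: "k < m" for k
  proof (cases "k = 0 \<or> \<not> (p - 1) dvd k")
    case True
    have "p_integral p (bern k)"
    proof (cases "k = 0")
      case True
      then show ?thesis using p_integral_Ints[OF p, of 1] by (simp add: bern_0)
    next
      case k0: False
      then have "\<not> (p - 1) dvd k" using True by simp
      \<comment> \<open>Here \<open>p\<close> is not 2, since \<open>p - 1 = 1\<close> would divide
        \<open>k\<close>; so the parity condition of \<open>von_staudt\<close> holds.\<close>
      then show ?thesis using von_staudt[OF p, of k] k0 by fastforce
    qed
    then show ?thesis using p_integral_mult p by simp
  next
    case False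
    have p2: "p \<ge> 2" using p prime_ge_2_nat by blast
    have "p - 1 \<le> digit_sum p k"
      using False digit_sum_pos[OF p2, of k] dvd_digit_sum_iff[OF p2] by (auto intro: dvd_imp_le)
    then have "p dvd (m choose k)"
      using digit_sum_less_if_not_dvd_choose[OF p k] s by force
    then obtain c where "m choose k = c * p" by (metis dvdE mult.commute)
    then have eq: "of_nat (m choose k) * bern k = of_nat c * (of_nat p * bern k)" by simp
    show ?thesis unfolding eq using p_integral_mult p_integral_times_bern p by simp
  qed
  then show ?thesis using p_integral_Ints[OF p, of 0] by (simp add: coeff_bern_poly)
qed

lemma p_integral_times_coeff_bern_poly:
  assumes "prime p"
  shows "p_integral p (of_nat p * coeff (bern_poly m) i)"
  using p_integral_mult[OF assms p_integral_of_nat p_integral_times_bern[OF assms], of "m choose (m - i)" "m - i"] assms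
    p_integral_Ints[OF assms, of 0]
  by (auto simp: coeff_bern_poly mult_ac)

text \<open>A \<open>k\<close> of digit sum exactly \<open>p - 1\<close> with
  \<open>m choose k\<close> prime to \<open>p\<close> works: \<open>p - 1\<close> divides
  \<open>k\<close>, so \<open>bern k\<close> is \<open>-1 / p\<close> up to a
  \<open>p\<close>-integral number.\<close>

lemma exists_coeff_bern_poly_not_p_integral:
  assumes p: "prime p" and s: "digit_sum p m \<ge> p"
  shows "\<exists>i. \<not> p_integral p (coeff (bern_poly m) i)"
proof -
  have p2: "p \<ge> 2" using p prime_ge_2_nat by blast
  obtain k where k: "k \<le> m" "digit_sum p k = p - 1" "\<not> p dvd (m choose k)"
    using exists_not_dvd_choose_digit_sum[OF p, of "p - 1" m] s le_trans[OF diff_le_self s] by blast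
  have k0: "k > 0" using k(2) p2 by (intro gr0I) (auto simp: digit_sum_def)
  have km: "k < m" using k s p2 by (intro le_neq_implies_less) auto
  have dvd: "(p - 1) dvd k" using dvd_digit_sum_iff[OF p2, of k] k(2) by simp
  \<comment> \<open>In base 2 the digit sum of \<open>k\<close> is 1, so an odd \<open>k\<close> has
    no digit besides its last.\<close>
  have even: "k = 1 \<or> even k" if "p = 2"
  proof -
    have "k = 2 * (k div 2) + 1" if "odd k" using that by simp
    then have "digit_sum 2 (k div 2) = 0" if "odd k"
      using that k(2) \<open>p = 2\<close> digit_sum_rec[of 2 1 "k div 2"] by simp
    then have "k div 2 = 0" if "odd k" using that digit_sum_pos[of 2 "k div 2"] by linarith
    then show ?thesis using k0 by fastforce
  qed
  have "p_integral p (bern k + 1 / of_nat p)" using von_staudt[OF p k0 even] dvd by simp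
  moreover have "\<not> p_integral p (1 / of_nat p)" using p_integral_inverse_iff[OF p, of p] p2 by simp
  ultimately have "\<not> p_integral p (bern k)" using p_integral_diff[OF p, of "bern k + 1 / of_nat p" "bern k"] by auto
  then have "\<not> p_integral p (of_nat (m choose k) * bern k)" using p_integral_cancel p k(3) by blast
  then show ?thesis using km k0 by (intro exI[of _ "m - k"]) (simp add: coeff_bern_poly)
qed

text \<open>The bound \<open>M_bound\<close> is absent because the digit sum condition implies it,
  as \<open>digit_primes_le_M_bound\<close> shows.\<close>

definition digit_primes :: "nat \<Rightarrow> nat set" where
  "digit_primes m = {p. prime p \<and> digit_sum p m \<ge> p}"

lemma finite_digit_primes: "finite (digit_primes m)"
proof (rule finite_subset)
  show "digit_primes m \<subseteq> {..m}"
  proof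
    fix p assume "p \<in> digit_primes m"
    then show "p \<in> {..m}"
      using digit_sum_le[of p m] prime_ge_2_nat[of p] by (simp add: digit_primes_def)
  qed
qed simp

lemma prod_digit_primes_pos: "\<Prod>(digit_primes m) > 0"
  by (rule prod_pos) (auto simp: digit_primes_def prime_gt_0_nat)

lemma prod_primes_dvd:
  fixes c :: nat
  assumes "finite A" "\<And>p. p \<in> A \<Longrightarrow> prime p \<and> p dvd c"
  shows "\<Prod>A dvd c"
  using assms
proof (induction A rule: finite_induct)
  case (insert p A)
  have "coprime p (\<Prod>A)"
    using insert.hyps insert.prems by (intro prod_coprime_right) (auto intro!: primes_coprime)
  then show ?case using insert by (simp add: divides_mult)
qed simp

text \<open>Integrality is tested prime by prime: a prime in \<open>digit_primes m\<close> occurs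
  exactly once in the common denominator, any other prime not at all.\<close>

lemma bern_poly_integral_iff:
  "(\<forall>i. of_nat c * coeff (bern_poly m) i \<in> \<int>) \<longleftrightarrow> \<Prod>(digit_primes m) dvd c"
proof
  assume int: "\<forall>i. of_nat c * coeff (bern_poly m) i \<in> \<int>"
  have "p dvd c" if "p \<in> digit_primes m" for p
  proof (rule ccontr)
    assume "\<not> p dvd c"
    then have "p_integral p (coeff (bern_poly m) i)" for i
      unfolding p_integral_def using int by blast
    then show False
      using that exists_coeff_bern_poly_not_p_integral unfolding digit_primes_def by blast
  qed
  then show "\<Prod>(digit_primes m) dvd c"
    using finite_digit_primes by (intro prod_primes_dvd) (auto simp: digit_primes_def)
next
  assume "\<Prod>(digit_primes m) dvd c"
  show "\<forall>i. of_nat c * coeff (bern_poly m) i \<in> \<int>"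
  proof (intro allI Ints_if_p_integral)
    fix i p assume p: "prime (p::nat)"
    show "p_integral p (of_nat c * coeff (bern_poly m) i)"
    proof (cases "p \<in> digit_primes m")
      case True
      then have "p dvd c"
        using \<open>\<Prod>(digit_primes m) dvd c\<close> finite_digit_primes dvd_prodI[of _ p "\<lambda>x. x"] dvd_trans by blast
      then obtain e where "c = e * p" by (metis dvdE mult.commute)
      then have eq: "of_nat c * coeff (bern_poly m) i = of_nat e * (of_nat p * coeff (bern_poly m) i)"
        by simp
      show ?thesis unfolding eq using p_integral_mult p_integral_times_coeff_bern_poly p by simp
    next
      case False
      then show ?thesis
        using p p_integral_mult p_integral_coeff_bern_poly by (simp add: digit_primes_def)
    qed
  qed
qed

section \<open>Denominators of the power sum polynomials\<close>

lemma power_sum_poly_integral_iff: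
  "(\<forall>i. coeff (smult (of_nat d) (power_sum_poly n)) i \<in> \<int>)
    \<longleftrightarrow> Suc n * \<Prod>(digit_primes (Suc n)) dvd d"
proof -
  have S: "coeff (power_sum_poly n) i = coeff (bern_poly (Suc n)) i / of_nat (Suc n)" for i
  proof -
    have "of_nat (Suc n) * coeff (power_sum_poly n) i = coeff (bern_poly (Suc n)) i"
      by (simp flip: power_sum_poly_eq del: of_nat_Suc)
    then show ?thesis by (simp add: field_simps del: of_nat_Suc)
  qed
  have *: "(\<forall>i. coeff (smult (of_nat (Suc n * c)) (power_sum_poly n)) i \<in> \<int>)
      \<longleftrightarrow> \<Prod>(digit_primes (Suc n)) dvd c" for c
  proof -
    have "coeff (smult (of_nat (Suc n * c)) (power_sum_poly n)) i
        = of_nat c * coeff (bern_poly (Suc n)) i" for i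
      by (simp add: S del: of_nat_Suc mult_Suc)
    then show ?thesis unfolding bern_poly_integral_iff[symmetric] by simp
  qed
  have "Suc n dvd d" if "\<forall>i. coeff (smult (of_nat d) (power_sum_poly n)) i \<in> \<int>"
  proof -
    \<comment> \<open>The leading coefficient of \<open>power_sum_poly n\<close> is
      \<open>1 / (n + 1)\<close>.\<close>
    have "of_nat d * (1 / of_nat (Suc n)) \<in> (\<int> :: rat set)"
      using that[rule_format, of "Suc n"] by (simp add: S coeff_bern_poly bern_0 del: of_nat_Suc) simp
    then obtain c where "of_nat d * (1 / of_nat (Suc n)) = (of_int c :: rat)" by (auto elim: Ints_cases)
    then have "(of_int (int d) :: rat) = of_int (c * int (Suc n))"
      by (simp add: field_simps del: of_nat_Suc)
    then have "int d = c * int (Suc n)" by (simp only: of_int_eq_iff)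
    then have "int (Suc n) dvd int d" by simp
    then show ?thesis by (simp only: of_nat_dvd_iff)
  qed
  moreover have ?thesis if "Suc n dvd d"
  proof -
    obtain c where "d = Suc n * c" using \<open>Suc n dvd d\<close> by auto
    then show ?thesis using *[of c] by (simp only: nat_mult_dvd_cancel_disj) simp
  qed
  ultimately show ?thesis using dvd_mult_left by blast
qed

lemma power_sum_denom_eq: "power_sum_denom n = Suc n * \<Prod>(digit_primes (Suc n))"
  unfolding power_sum_denom_def power_sum_poly_integral_iff
proof (rule Least_equality)
  show "Suc n * \<Prod>(digit_primes (Suc n)) > 0
      \<and> Suc n * \<Prod>(digit_primes (Suc n)) dvd Suc n * \<Prod>(digit_primes (Suc n))"
    using prod_digit_primes_pos by simp
qed (simp only: dvd_imp_le)

lemma q_seq_eq: "q_seq n = \<Prod>(digit_primes (Suc n))"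
  by (simp add: q_seq_def power_sum_denom_eq del: mult_Suc)

lemma q_seq_pos: "q_seq n > 0"
  by (simp add: q_seq_eq prod_digit_primes_pos)

lemma prime_dvd_q_seq: "prime p \<Longrightarrow> digit_sum p (Suc n) \<ge> p \<Longrightarrow> p dvd q_seq n"
  unfolding q_seq_eq using finite_digit_primes
  by (intro dvd_prodI[of _ p "\<lambda>x. x", simplified]) (auto simp: digit_primes_def)

text \<open>With \<open>m = b p + a\<close>, the digit sum is at most \<open>a + b\<close>. The quotient \<open>b = 1\<close> forces
  \<open>m = 2 p - 1\<close>, and \<open>b \<ge> 2\<close> gives \<open>m \<ge> 3 p - 2\<close>, where equality with \<open>m\<close> even would mean
  \<open>p = 2\<close> and \<open>m = 4\<close>.\<close>

lemma digit_sum_ge_imp_bound: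
  assumes p: "prime p" and s: "digit_sum p m \<ge> p"
  shows "if odd m then 2 * p \<le> m + 1 else 3 * p \<le> m + 1"
proof -
  have p2: "p \<ge> 2" using p prime_ge_2_nat by blast
  define a b where "a = m mod p" and "b = m div p"
  have m: "m = p * b + a" and a: "a < p" using p2 by (auto simp: a_def b_def)
  have sm: "digit_sum p m = digit_sum p b + a" using digit_sum_rec[OF p2 a] m by simp
  have "digit_sum p b \<le> b" using digit_sum_le[OF p2] .
  then have ab: "a + b \<ge> p" using s sm by linarith
  consider "b = 0" | "b = 1" | "b = 2" | "b \<ge> 3" by linarith
  then show ?thesis
  proof cases
    case 1
    then show ?thesis using ab a by simp
  next
    case 2
    then have "m = 2 * p - 1" using ab a m by simp
    then have "m + 1 = 2 * p" using p2 by simp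
    then show ?thesis by (metis even_add even_mult_iff odd_one order_refl even_numeral)
  next
    case 3
    then have ge: "m + 2 \<ge> 3 * p" using ab m by simp
    show ?thesis
    proof (cases "m + 2 = 3 * p \<and> even m")
      case True
      then have "even p" by (metis even_add even_mult_iff even_numeral odd_numeral)
      then have "p = 2" using p primes_dvd_imp_eq two_is_prime_nat by blast
      then have "a = 0" using True m 3 by simp
      \<comment> \<open>So \<open>m = 4\<close> has binary digit sum 1, contradicting the assumption
        that it is at least \<open>p = 2\<close>.\<close>
      moreover have "digit_sum 2 2 = (1::nat)" using digit_sum_rec[of 2 0 1] by (simp add: digit_sum_less)
      ultimately show ?thesis using sm s \<open>p = 2\<close> 3 by simp
    next
      case False
      \<comment> \<open>For even \<open>m\<close> the inequality \<open>ge\<close> is strict; for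
        odd \<open>m\<close> it already exceeds the weaker goal.\<close>
      then show ?thesis using ge p2 by auto
    qed
  next
    case 4
    then have "p * 3 \<le> p * b" by (rule mult_le_mono2)
    then have "3 * p \<le> m" unfolding m by linarith
    then show ?thesis by simp
  qed
qed

lemma digit_primes_le_M_bound:
  assumes "p \<in> digit_primes (n + 1)"
  shows "of_nat p \<le> M_bound n"
proof -
  have *: "if even n then 2 * p \<le> n + 2 else 3 * p \<le> n + 2"
    using digit_sum_ge_imp_bound[of p "n + 1"] assms by (auto simp: digit_primes_def split: if_splits)
  show ?thesis
  proof (cases "even n")
    case True
    then have "of_nat (2 * p) \<le> (of_nat (n + 2) :: rat)" using * by (simp only: of_nat_le_iff if_True)
    then show ?thesis using True by (simp add: M_bound_def)
  next
    case False
    then have "of_nat (3 * p) \<le> (of_nat (n + 2) :: rat)" using * by (simp only: of_nat_le_iff if_False)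
    then show ?thesis using False by (simp add: M_bound_def)
  qed
qed

section \<open>Sharpness of the bound\<close>

lemma even_sharp:
  assumes "prime p"
  shows "M_bound (2 * p - 2) = of_nat p" "p dvd q_seq (2 * p - 2)"
proof -
  have p2: "p \<ge> 2" using assms prime_ge_2_nat by blast
  show "M_bound (2 * p - 2) = of_nat p" using p2 by (simp add: M_bound_def of_nat_diff)
  \<comment> \<open>The base-\<open>p\<close> digits are 1 and \<open>p - 1\<close>, whose sum is
    exactly \<open>p\<close>.\<close>
  have "Suc (2 * p - 2) = p * 1 + (p - 1)" using p2 by simp
  then have "digit_sum p (Suc (2 * p - 2)) = digit_sum p 1 + (p - 1)"
    using digit_sum_rec[of p "p - 1" 1] p2 by simp
  then show "p dvd q_seq (2 * p - 2)"
    using p2 assms digit_sum_less[of p 1] by (intro prime_dvd_q_seq) auto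
qed

lemma odd_sharp:
  assumes "prime p" "p > 2"
  shows "odd (3 * p - 2)" "M_bound (3 * p - 2) = of_nat p" "p dvd q_seq (3 * p - 2)"
proof -
  show odd: "odd (3 * p - 2)" using assms prime_odd_nat by auto
  show "M_bound (3 * p - 2) = of_nat p" using odd assms by (simp add: M_bound_def of_nat_diff)
  \<comment> \<open>The digits are 2 and \<open>p - 1\<close>, with sum \<open>p + 1\<close>;
    \<open>p > 2\<close> makes 2 a legal digit.\<close>
  have "Suc (3 * p - 2) = p * 2 + (p - 1)" using assms by simp
  then have "digit_sum p (Suc (3 * p - 2)) = digit_sum p 2 + (p - 1)"
    using digit_sum_rec[of p "p - 1" 2] assms by simp
  then show "p dvd q_seq (3 * p - 2)"
    using assms digit_sum_less[of p 2] by (intro prime_dvd_q_seq) auto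
qed

lemma infinite_odd_primes: "infinite {p::nat. prime p \<and> p > 2}"
proof -
  have "{p::nat. prime p} \<subseteq> {p. prime p \<and> p > 2} \<union> {..2}" by auto
  then show ?thesis using primes_infinite finite_subset by blast
qed

theorem theorem2:
  shows "(\<forall>n. (n + 1) dvd power_sum_denom n \<and>
              q_seq n = \<Prod>{p. prime p \<and> of_nat p \<le> M_bound n \<and> digit_sum p (n + 1) \<ge> p})
       \<and> infinite {n. even n \<and> (\<exists>p. prime p \<and> M_bound n = of_nat p \<and> p dvd q_seq n)}
       \<and> infinite {n. odd n \<and> (\<exists>p. prime p \<and> M_bound n = of_nat p \<and> p dvd q_seq n)}
       \<and> \<not> bdd_above (range q_seq)"
proof (intro conjI allI)
  fix n
  show "(n + 1) dvd power_sum_denom n" by (simp add: power_sum_denom_eq del: mult_Suc)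
  have "digit_primes (n + 1) = {p. prime p \<and> of_nat p \<le> M_bound n \<and> digit_sum p (n + 1) \<ge> p}"
    using digit_primes_le_M_bound[of _ n] by (auto simp: digit_primes_def)
  then show "q_seq n = \<Prod>{p. prime p \<and> of_nat p \<le> M_bound n \<and> digit_sum p (n + 1) \<ge> p}"
    by (simp add: q_seq_eq)
next
  have "infinite ((\<lambda>p::nat. 2 * p - 2) ` {p. prime p \<and> p > 2})"
    by (subst finite_image_iff) (auto simp: inj_on_def infinite_odd_primes)
  moreover have "(\<lambda>p::nat. 2 * p - 2) ` {p. prime p \<and> p > 2}
      \<subseteq> {n. even n \<and> (\<exists>p. prime p \<and> M_bound n = of_nat p \<and> p dvd q_seq n)}"
    using even_sharp by auto
  ultimately show "infinite {n. even n \<and> (\<exists>p. prime p \<and> M_bound n = of_nat p \<and> p dvd q_seq n)}"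
    using finite_subset by blast
next
  have "infinite ((\<lambda>p::nat. 3 * p - 2) ` {p. prime p \<and> p > 2})"
    by (subst finite_image_iff) (auto simp: inj_on_def infinite_odd_primes)
  moreover have "(\<lambda>p::nat. 3 * p - 2) ` {p. prime p \<and> p > 2}
      \<subseteq> {n. odd n \<and> (\<exists>p. prime p \<and> M_bound n = of_nat p \<and> p dvd q_seq n)}"
    using odd_sharp by auto
  ultimately show "infinite {n. odd n \<and> (\<exists>p. prime p \<and> M_bound n = of_nat p \<and> p dvd q_seq n)}"
    using finite_subset by blast
next
  show "\<not> bdd_above (range q_seq)"
  proof
    assume "bdd_above (range q_seq)"
    then obtain N where N: "\<And>n. q_seq n \<le> N" by (auto simp: bdd_above_def)
    obtain p where p: "prime p" "p > N" using bigger_prime by blast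
    \<comment> \<open>Sharpness in the even case gives a prime divisor beyond the supposed bound
      \<open>N\<close>.\<close>
    have "p \<le> q_seq (2 * p - 2)" using even_sharp(2)[OF p(1)] q_seq_pos dvd_imp_le by blast
    then show False using N[of "2 * p - 2"] p(2) by linarith
  qed
qed

end
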